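(* Let $\mathbf{E}$ be a Euclidean space, let $A,B$ be closed nonempty subsets of $\mathbf{E}$, let $\hat x\in S:=A\cap B$, let $\delta>0$, and let the collection $\{A,B\}$ be locally linearly regular at $\hat x$ on $\mathbb{B}_\delta(\hat x)$ with regularity modulus $\kappa>0$. Define $\gamma:=1/\kappa$ and let $x_0\in A$. Let $\{x_n\}_{n\in\mathbb{N}}$ be any sequence generated by $$x_{2n+1}\in P_B x_{2n}\quad\text{and}\quad x_{2n+2}\in P_A x_{2n+1}\qquad\forall n=0,1,2,\dots.$$ (a) If $A$ and $B$ are $(\varepsilon,\delta)$-subregular at $\hat x$ with respect to $S$ and $\tilde\varepsilon:=2\varepsilon+2\varepsilon^2\le\gamma^2$, then for all $x_0\in\mathbb{B}_{\delta/2}(\hat x)\cap A$ $$d(x_{2n+2},S)\le(1-\gamma^2+\tilde\varepsilon)\,d(x_{2n},S)\qquad\forall n=0,1,2,\dots.$$ (b) If $A$ is $(\varepsilon,\delta)$-subregular at $\hat x$ with respect to $S$, $B$ is convex and $\tilde\varepsilon:=2\varepsilon+2\varepsilon^2\le(2\gamma-\gamma^2)/(1-\gamma^2)$, then for all $x_0\in\mathbb{B}_{\delta/2}(\hat x)\cap A$ $$d(x_{2n+2},S)\le\sqrt{1-\gamma^2+\tilde\varepsilon}\,\sqrt{1-\gamma^2}\;d(x_{2n},S)\qquad\forall n=0,1,2,\dots.$$ (c) If $A$ and $B$ are convex, then for all $x_0\in\mathbb{B}_\delta(\hat x)\cap A$ $$d(x_{2n+2},S)\le(1-\gamma^2)\,d(x_{2n},S)\qquad\forall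 n=0,1,2,\dots.$$
   Context: $\mathbf{E}$ is a (finite-dimensional) Euclidean space; $\mathbb{B}_\delta(\hat x)=\{x\in\mathbf{E}:\|x-\hat x\|\le\delta\}$. For nonempty $\Omega\subset\mathbf{E}$, $d(x,\Omega)=\inf_{y\in\Omega}\|x-y\|$ and the (possibly multi-valued) projector is $P_\Omega x=P_\Omega(x)=\{y\in\Omega:\|x-y\|=d(x,\Omega)\}$. The proximal normal cone to $\Omega$ at $x\in\Omega$ is $N^P_\Omega(x)=\mathrm{cone}(P_\Omega^{-1}(x)-x)$, where $P_\Omega^{-1}(x)=\{w\in\mathbf{E}:x\in P_\Omega(w)\}$ and $\mathrm{cone}(K)$ is the smallest set containing $K$ that is closed under multiplication by positive scalars. For $\varepsilon\ge0$, $\delta>0$, a nonempty set $\Omega\subset\mathbf{E}$ is $(\varepsilon,\delta)$-subregular at $\hat x$ with respect to $S\subset\mathbf{E}$ if $\langle v_x,\bar x-x\rangle\le\varepsilon\|v_x\|\|\bar x-x\|$ for all $x\in\mathbb{B}_\delta(\hat x)\cap\Omega$, all $\bar x\in S\cap\mathbb{B}_\delta(\hat x)$ and all $v_x\in N^P_\Omega(x)$. The collection $\{A,B\}$ of closed nonempty sets is locally linearly regular at $\hat x\in A\cap B$ on $\mathbb{B}_\delta(\hat x)$ if there is $\kappa>0$ such that $d(x,A\cap B)\le\kappa\max\{d(x,A),d(x,B)\}$ for all $x\in\mathbb{B}_\delta(\hat x)$. The infimum of all such $\kappa$ is called the regularity modulus (on $\mathbb{B}_\delta(\hat x)$). *)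

theory Defs
  imports "HOL-Analysis.Analysis"
begin

definition projector :: "'a::euclidean_space set \<Rightarrow> 'a \<Rightarrow> 'a set" where
  "projector \<Omega> x = {y \<in> \<Omega>. norm (x - y) = infdist x \<Omega>}"

(* The library's cone hull also closes under the scalar 0; here only positive scalars are used. *)
definition pos_cone :: "'a::euclidean_space set \<Rightarrow> 'a set" where
  "pos_cone K = (\<lambda>C. \<forall>c>0. \<forall>v\<in>C. c *\<^sub>R v \<in> C) hull K"

definition proximal_normal_cone :: "'a::euclidean_space set \<Rightarrow> 'a \<Rightarrow> 'a set" where
  "proximal_normal_cone \<Omega> x = pos_cone ((\<lambda>w. w - x) ` {w. x \<in> projector \<Omega> w})"

definition subregular ::
    "real \<Rightarrow> real \<Rightarrow> 'a::euclidean_space set \<Rightarrow> 'a \<Rightarrow> 'a set \<Rightarrow> bool" where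
  "subregular \<epsilon> \<delta> \<Omega> xh S \<longleftrightarrow>
     (\<forall>x \<in> cball xh \<delta> \<inter> \<Omega>. \<forall>xb \<in> S \<inter> cball xh \<delta>. \<forall>v \<in> proximal_normal_cone \<Omega> x.
        inner v (xb - x) \<le> \<epsilon> * norm v * norm (xb - x))"

definition regularity_constants ::
    "'a::euclidean_space set \<Rightarrow> 'a set \<Rightarrow> 'a \<Rightarrow> real \<Rightarrow> real set" where
  "regularity_constants A B xh \<delta> =
     {\<kappa>. \<kappa> > 0 \<and> (\<forall>x \<in> cball xh \<delta>.
        infdist x (A \<inter> B) \<le> \<kappa> * max (infdist x A) (infdist x B))}"

definition locally_linearly_regular ::
    "'a::euclidean_space set \<Rightarrow> 'a set \<Rightarrow> 'a \<Rightarrow> real \<Rightarrow> bool" where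
  "locally_linearly_regular A B xh \<delta> \<longleftrightarrow> regularity_constants A B xh \<delta> \<noteq> {}"

definition regularity_modulus ::
    "'a::euclidean_space set \<Rightarrow> 'a set \<Rightarrow> 'a \<Rightarrow> real \<Rightarrow> real" where
  "regularity_modulus A B xh \<delta> = Inf (regularity_constants A B xh \<delta>)"

end

theory Submission
  imports Defs
begin

text \<open>
  Write \<open>a = |x - y|\<close> for a projection step from \<open>x\<close> in one set to \<open>y\<close> in the other, and
  \<open>d\<close> for the distance to \<open>S\<close>. Regularity at \<open>x\<close> gives \<open>a \<ge> \<gamma> d(x)\<close>, and subregularity
  gives \<open>|y - s|\<^sup>2 + a\<^sup>2 \<le> |x - s|\<^sup>2 + 2 \<epsilon> a |y - s|\<close> for \<open>s\<close> in \<open>S\<close> within the ball; together these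
  are the asserted rates, as long as the iterates and their nearest points of \<open>S\<close> stay in the ball.

  The difficulty is that a step may move away from the centre, by up to \<open>\<epsilon> a\<close>.
  The invariant is that (distance to the centre) + \<open>d\<close> \<open>\<le> \<delta>\<close>, so \<open>d\<close> has to drop by at
  least \<open>\<epsilon> a\<close> (in each step for (a), in each cycle for (b)). Regularity at the iterates alone does
  not give this; regularity at the midpoint of \<open>x\<close> and \<open>y\<close>, whose distance to both sets is at
  most \<open>a / 2\<close>, yields \<open>2 \<gamma>\<^sup>2 (d(x)\<^sup>2 + d(y)\<^sup>2) \<le> (1 + \<gamma>\<^sup>2) a\<^sup>2\<close>, and this suffices.
\<close>

section \<open>Scalar inequalities that force the distance to the intersection to drop\<close>

text \<open>\<open>big\<close> is what a failing decrease leaves after squaring and inserting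
  \<open>tp\<close>: \<open>q = 1\<close> for one projection, \<open>q = 2\<close> for a cycle. Its
  product with its own shift by \<open>4 * \<epsilon>\<^sup>2 * a\<close> bounds
  \<open>b * (b - \<epsilon> * a)\<close> from below, \<open>tp\<close> and \<open>mid\<close> bound
  it from above, both by multiples of \<open>a\<^sup>2\<close>. Cancelling \<open>a\<^sup>2\<close>
  leaves a relation between \<gamma> and \<epsilon> alone.\<close>

lemma median_bound:
  fixes \<epsilon> \<gamma> a b c q :: real
  assumes "0 < a" "0 \<le> \<epsilon>" "0 \<le> b" and q: "5 * \<epsilon>\<^sup>2 \<le> q"
    and tp: "b\<^sup>2 + a\<^sup>2 \<le> c\<^sup>2 + 2 * \<epsilon> * a * b"
    and mid: "2 * \<gamma>\<^sup>2 * (c\<^sup>2 + b\<^sup>2) \<le> (1 + \<gamma>\<^sup>2) * a\<^sup>2"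
    and big: "(q - \<epsilon>\<^sup>2) * a < 4 * \<epsilon> * b"
  shows "\<gamma>\<^sup>2 * (q\<^sup>2 - (6 * q - 4) * \<epsilon>\<^sup>2) \<le> 4 * \<epsilon>\<^sup>2"
proof -
  have k2: "(q - 5 * \<epsilon>\<^sup>2) * a < 4 * \<epsilon> * (b - \<epsilon> * a)"
    using big by (simp add: algebra_simps power2_eq_square)
  have nn: "0 \<le> 4 * \<epsilon> * b" "0 \<le> (q - 5 * \<epsilon>\<^sup>2) * a" using assms(1-4) by simp_all
  have "((q - \<epsilon>\<^sup>2) * a) * ((q - 5 * \<epsilon>\<^sup>2) * a) \<le> (4 * \<epsilon> * b) * (4 * \<epsilon> * (b - \<epsilon> * a))"
    using nn by (rule mult_mono[OF less_imp_le[OF big] less_imp_le[OF k2]])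
  then have k3: "(q - \<epsilon>\<^sup>2) * (q - 5 * \<epsilon>\<^sup>2) * a\<^sup>2 \<le> 4 * \<epsilon>\<^sup>2 * (4 * (b * (b - \<epsilon> * a)))"
    by (simp add: algebra_simps power2_eq_square)
  have "2 * \<gamma>\<^sup>2 * (b\<^sup>2 + a\<^sup>2 - 2 * \<epsilon> * a * b + b\<^sup>2) \<le> 2 * \<gamma>\<^sup>2 * (c\<^sup>2 + b\<^sup>2)"
    using tp by (intro mult_left_mono) auto
  also note mid
  finally have k4: "\<gamma>\<^sup>2 * (4 * (b * (b - \<epsilon> * a))) \<le> (1 - \<gamma>\<^sup>2) * a\<^sup>2"
    by (simp add: algebra_simps power2_eq_square)
  have "\<gamma>\<^sup>2 * ((q - \<epsilon>\<^sup>2) * (q - 5 * \<epsilon>\<^sup>2) * a\<^sup>2) \<le> \<gamma>\<^sup>2 * (4 * \<epsilon>\<^sup>2 * (4 * (b * (b - \<epsilon> * a))))"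
    using k3 by (intro mult_left_mono) auto
  also have "\<dots> = 4 * \<epsilon>\<^sup>2 * (\<gamma>\<^sup>2 * (4 * (b * (b - \<epsilon> * a))))" by simp
  also have "\<dots> \<le> 4 * \<epsilon>\<^sup>2 * ((1 - \<gamma>\<^sup>2) * a\<^sup>2)" using k4 by (intro mult_left_mono) auto
  finally have "(\<gamma>\<^sup>2 * ((q - \<epsilon>\<^sup>2) * (q - 5 * \<epsilon>\<^sup>2))) * a\<^sup>2 \<le> (4 * \<epsilon>\<^sup>2 * (1 - \<gamma>\<^sup>2)) * a\<^sup>2"
    by (simp add: mult_ac)
  then have "\<gamma>\<^sup>2 * ((q - \<epsilon>\<^sup>2) * (q - 5 * \<epsilon>\<^sup>2)) \<le> 4 * \<epsilon>\<^sup>2 * (1 - \<gamma>\<^sup>2)"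
    using assms(1) by simp
  moreover have "\<gamma>\<^sup>2 * (q\<^sup>2 - (6 * q - 4) * \<epsilon>\<^sup>2)
      = \<gamma>\<^sup>2 * ((q - \<epsilon>\<^sup>2) * (q - 5 * \<epsilon>\<^sup>2)) + 4 * \<epsilon>\<^sup>2 * \<gamma>\<^sup>2 - 5 * (\<gamma> * \<epsilon>\<^sup>2)\<^sup>2"
    by algebra
  moreover have "0 \<le> (\<gamma> * \<epsilon>\<^sup>2)\<^sup>2" by simp
  ultimately show ?thesis by (simp only: right_diff_distrib)
qed

text \<open>\<open>c\<close> and \<open>b\<close> are the distances to \<open>S\<close> before and
  after a projection of length \<open>a\<close>; \<open>N\<close> is measured to the point of
  \<open>S\<close> nearest to the old iterate, so it only dominates \<open>b\<close>. Failure would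
  make \<gamma> too small by \<open>median_bound\<close> for the lower bound on
  \<open>\<gamma>\<^sup>2\<close> in \<open>eps\<close>.\<close>

lemma step_decrease:
  fixes \<epsilon> \<gamma> a b c N :: real
  assumes eps: "0 \<le> \<epsilon>" "2 * \<epsilon> + 2 * \<epsilon>\<^sup>2 \<le> \<gamma>\<^sup>2" and gam: "0 < \<gamma>" "\<gamma> \<le> 1"
    and ac: "0 \<le> a" "a \<le> c" and b: "0 \<le> b" "b \<le> N"
    and tp: "N\<^sup>2 + a\<^sup>2 \<le> c\<^sup>2 + 2 * \<epsilon> * a * N"
    and mid: "2 * \<gamma>\<^sup>2 * (c\<^sup>2 + b\<^sup>2) \<le> (1 + \<gamma>\<^sup>2) * a\<^sup>2"
  shows "b + \<epsilon> * a \<le> c"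
proof (rule ccontr)
  assume "\<not> b + \<epsilon> * a \<le> c"
  then have viol: "c < b + \<epsilon> * a" by simp
  have g1: "\<gamma>\<^sup>2 \<le> 1" using gam by (simp add: power_le_one)
  have g0: "0 < \<gamma>\<^sup>2" using gam by simp
  \<comment> \<open>Since \<open>\<gamma> \<le> 1\<close>, \<epsilon> is at most the positive root
    of \<open>2 * \<epsilon> + 2 * \<epsilon>\<^sup>2 = 1\<close>, about 0.366; 2/5 is a round
    number above it.\<close>
  have e4: "\<epsilon> < 2 / 5"
  proof (rule ccontr)
    assume "\<not> \<epsilon> < 2 / 5"
    then have "(2 / 5)\<^sup>2 \<le> \<epsilon>\<^sup>2" "2 / 5 \<le> \<epsilon>" by (auto intro: power_mono)
    with eps(2) g1 show False by (simp add: power2_eq_square)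
  qed
  have e2: "\<epsilon>\<^sup>2 \<le> 4 / 25" using power_mono[of \<epsilon> "2/5" 2] eps e4 by (simp add: power2_eq_square)
  \<comment> \<open>\<open>t\<^sup>2 - 2 * \<epsilon> * a * t\<close> increases only for
    \<open>t \<ge> \<epsilon> * a\<close>, so this bound is what allows \<open>N\<close> to be
    lowered to \<open>b\<close> in \<open>tp\<close>.\<close>
  have bea: "\<epsilon> * a \<le> b"
  proof (rule ccontr)
    assume "\<not> \<epsilon> * a \<le> b"
    moreover have "\<epsilon> * a \<le> (2/5) * a" using e4 ac by (intro mult_right_mono) auto
    ultimately show False using viol ac by linarith
  qed
  have "(b - \<epsilon> * a)\<^sup>2 \<le> (N - \<epsilon> * a)\<^sup>2" using bea b by (intro power_mono) auto
  with tp have tpb: "b\<^sup>2 + a\<^sup>2 \<le> c\<^sup>2 + 2 * \<epsilon> * a * b"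
    by (simp add: power2_diff algebra_simps)
  have a0: "0 < a"
  proof (rule ccontr)
    assume "\<not> 0 < a"
    then have "a = 0" using ac by simp
    with mid have "\<gamma>\<^sup>2 * (c\<^sup>2 + b\<^sup>2) \<le> 0" by simp
    then have "b = 0"
      using g0 by (simp add: mult_le_0_iff sum_power2_le_zero_iff)
    with viol ac \<open>a = 0\<close> show False by simp
  qed
  have "c\<^sup>2 < (b + \<epsilon> * a)\<^sup>2" using viol ac by (intro power_strict_mono) auto
  with tpb have "a * ((1 - \<epsilon>\<^sup>2) * a) < a * (4 * \<epsilon> * b)"
    by (simp add: power2_sum algebra_simps power2_eq_square)
  then have k1: "(1 - \<epsilon>\<^sup>2) * a < 4 * \<epsilon> * b" using a0 by simp
  have "\<gamma>\<^sup>2 * (1 - 2 * \<epsilon>\<^sup>2) \<le> 4 * \<epsilon>\<^sup>2"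
    using median_bound[of a \<epsilon> b 1 c \<gamma>] a0 eps b e2 tpb mid k1 by simp
  moreover have "(2 * \<epsilon> + 2 * \<epsilon>\<^sup>2) * (1 - 2 * \<epsilon>\<^sup>2) \<le> \<gamma>\<^sup>2 * (1 - 2 * \<epsilon>\<^sup>2)"
    using eps e2 by (intro mult_right_mono) auto
  ultimately have "\<epsilon> * ((1 + \<epsilon>) * (1 - 2 * \<epsilon>\<^sup>2) - 2 * \<epsilon>) \<le> 0"
    by (simp add: algebra_simps power2_eq_square)
  moreover have "\<epsilon> > 0" using k1 e2 a0 b eps(1)
    by (cases "\<epsilon> = 0") auto
  ultimately have "(1 + \<epsilon>) * (1 - 2 * \<epsilon>\<^sup>2) \<le> 2 * \<epsilon>" by (simp add: mult_le_0_iff)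
  moreover have "(1 + \<epsilon>) * (17/25) \<le> (1 + \<epsilon>) * (1 - 2 * \<epsilon>\<^sup>2)"
    using e2 eps by (intro mult_left_mono) auto
  ultimately show False using e4 by simp
qed

text \<open>The bound on \<open>\<epsilon>\<close> in (b), solved for \<open>\<gamma>\<close>: any \<open>m\<close> that violates it bounds \<open>\<gamma>\<close> from below.\<close>

lemma gamma_ge:
  fixes \<epsilon> \<gamma> m :: real
  assumes "0 \<le> \<epsilon>" "0 < \<gamma>" "\<gamma> < 1" and m: "m \<le> 1"
    and hyp: "2 * \<epsilon> + 2 * \<epsilon>\<^sup>2 \<le> (2 * \<gamma> - \<gamma>\<^sup>2) / (1 - \<gamma>\<^sup>2)"
    and mm: "0 \<le> (2 * \<epsilon> + 2 * \<epsilon>\<^sup>2) * (1 - m\<^sup>2) - (2 * m - m\<^sup>2)"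
  shows "m \<le> \<gamma>"
proof (rule ccontr)
  assume "\<not> m \<le> \<gamma>"
  then have lt: "\<gamma> < m" by simp
  have g: "0 < 1 - \<gamma>\<^sup>2" using assms by (simp add: power_less_one_iff abs_square_less_1)
  then have h: "(2 * \<epsilon> + 2 * \<epsilon>\<^sup>2) * (1 - \<gamma>\<^sup>2) \<le> 2 * \<gamma> - \<gamma>\<^sup>2"
    using hyp by (simp add: pos_le_divide_eq)
  have "2 * m - m\<^sup>2 \<le> (2 * \<epsilon> + 2 * \<epsilon>\<^sup>2) * (1 - m\<^sup>2)" using mm by (rule iffD1[OF diff_ge_0_iff_ge])
  also have "\<gamma>\<^sup>2 \<le> m\<^sup>2" using lt assms(2) by (intro power_mono) auto
  then have "(2 * \<epsilon> + 2 * \<epsilon>\<^sup>2) * (1 - m\<^sup>2) \<le> (2 * \<epsilon> + 2 * \<epsilon>\<^sup>2) * (1 - \<gamma>\<^sup>2)"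
    using assms(1) by (intro mult_left_mono) auto
  also note h
  finally have "(m - \<gamma>) * (2 - m - \<gamma>) \<le> 0" by (simp add: power2_eq_square algebra_simps)
  moreover have "0 < (m - \<gamma>) * (2 - m - \<gamma>)" using lt m by (intro mult_pos_pos) auto
  ultimately show False by simp
qed

text \<open>For \<open>m = \<epsilon> * (10 + 7 * \<epsilon>) / 10\<close>, the expression in
  assumption \<open>mm\<close> of \<open>gamma_ge\<close> is this polynomial times
  \<open>\<epsilon>\<^sup>2 / 100\<close>. Bounding each factor by its value at 9/20
  suffices.\<close>

lemma poly_small_margin:
  fixes \<epsilon> :: real
  assumes "0 \<le> \<epsilon>" "\<epsilon> \<le> 9 / 20"
  shows "0 \<le> 60 + (10 + 7 * \<epsilon>)\<^sup>2 * (1 - 2 * \<epsilon> - 2 * \<epsilon>\<^sup>2)"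
proof -
  define k where "k = (10 + 7 * \<epsilon>)\<^sup>2"
  have "\<epsilon>\<^sup>2 \<le> (9 / 20)\<^sup>2" using assms by (intro power_mono)
  then have "- (61 / 200) \<le> 1 - 2 * \<epsilon> - 2 * \<epsilon>\<^sup>2" using assms by (simp add: power2_eq_square)
  then have "k * - (61 / 200) \<le> k * (1 - 2 * \<epsilon> - 2 * \<epsilon>\<^sup>2)"
    by (rule mult_left_mono) (simp add: k_def)
  moreover have "k \<le> (263 / 20)\<^sup>2" unfolding k_def using assms by (intro power_mono) auto
  ultimately show ?thesis unfolding k_def[symmetric] by (simp add: power2_eq_square)
qed

text \<open>With \<open>m = n / 30\<close>, the first polynomial is assumption \<open>mm\<close> of
  \<open>gamma_ge\<close>, the second is \<open>1 \<le> m\<^sup>2 * (1 + 2 * w\<^sup>2)\<close> for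
  \<open>w = 707/500 - \<epsilon>\<close>, both cleared of denominators. The factor 14641 is
  \<open>11 ^ 4\<close>, because \<open>(20 * \<epsilon> - 9) + 20 * (1 - \<epsilon>) = 11\<close>
  and the degree is 4.\<close>

lemma poly_large_margin:
  fixes \<epsilon> n :: real
  assumes "9 / 20 \<le> \<epsilon>" "\<epsilon> \<le> 1" and n: "n = 11 + 15 * \<epsilon>"
  shows "0 \<le> (2 * \<epsilon> + 2 * \<epsilon>\<^sup>2) * (900 - n\<^sup>2) - (60 * n - n\<^sup>2)"
    and "0 \<le> n\<^sup>2 * (250000 + 2 * (707 - 500 * \<epsilon>)\<^sup>2) - 225000000"
proof -
  have nn: "0 \<le> 20 * \<epsilon> - 9" "0 \<le> 1 - \<epsilon>" using assms by simp_all
  note nonneg = add_nonneg_nonneg mult_nonneg_nonneg zero_le_power nn zero_le_numeral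
  \<comment> \<open>Bernstein form on the interval.\<close>
  have eq: "14641 * ((2 * \<epsilon> + 2 * \<epsilon>\<^sup>2) * (900 - n\<^sup>2) - (60 * n - n\<^sup>2))
      = 2144950 * (1 - \<epsilon>) ^ 4 + 5534530 * ((20 * \<epsilon> - 9) * (1 - \<epsilon>) ^ 3)
        + 686413 * ((20 * \<epsilon> - 9) ^ 2 * (1 - \<epsilon>) ^ 2)
        + 21816 * ((20 * \<epsilon> - 9) ^ 3 * (1 - \<epsilon>)) + 12 * (20 * \<epsilon> - 9) ^ 4"
    unfolding n by algebra
  show "0 \<le> (2 * \<epsilon> + 2 * \<epsilon>\<^sup>2) * (900 - n\<^sup>2) - (60 * n - n\<^sup>2)"
    by (rule mult_left_le_imp_le[where c = 14641], unfold eq mult_zero_right)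
      (intro nonneg, simp)
  have eq: "14641 * (n\<^sup>2 * (250000 + 2 * (707 - 500 * \<epsilon>)\<^sup>2) - 225000000)
      = 25405680000 * (1 - \<epsilon>) ^ 4 + 343132300000 * ((20 * \<epsilon> - 9) * (1 - \<epsilon>) ^ 3)
        + 27493402850 * ((20 * \<epsilon> - 9) ^ 2 * (1 - \<epsilon>) ^ 2)
        + 352763000 * ((20 * \<epsilon> - 9) ^ 3 * (1 - \<epsilon>)) + 1931848 * (20 * \<epsilon> - 9) ^ 4"
    unfolding n by algebra
  show "0 \<le> n\<^sup>2 * (250000 + 2 * (707 - 500 * \<epsilon>)\<^sup>2) - 225000000"
    by (rule mult_left_le_imp_le[where c = 14641], unfold eq mult_zero_right)
      (intro nonneg, simp)
qed

text \<open>
  The two lower bounds for \<open>\<gamma>\<close> used here, \<open>\<epsilon> (1 + 7/10 \<epsilon>)\<close> for \<open>\<epsilon> \<le> 9/20\<close> and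
  \<open>(11 + 15 \<epsilon>)/30\<close> beyond, are hand-picked minorants of the smallest \<open>\<gamma>\<close> that \<open>hyp\<close> admits.
  For \<open>\<epsilon> \<ge> 9/20\<close> the bounds \<open>c \<ge> a\<close> and \<open>e\<^sup>2 \<ge> 2 a\<^sup>2\<close> alone contradict \<open>mid\<close>; 707/500
  approximates the square root of 2 from below.
\<close>

lemma cycle_decrease:
  fixes \<epsilon> \<gamma> a b c e p N :: real
  assumes eps: "0 \<le> \<epsilon>" "\<epsilon> \<le> 1"
    and hyp: "\<gamma> \<noteq> 1 \<longrightarrow> 2 * \<epsilon> + 2 * \<epsilon>\<^sup>2 \<le> (2 * \<gamma> - \<gamma>\<^sup>2) / (1 - \<gamma>\<^sup>2)"
    and gam: "0 < \<gamma>" "\<gamma> \<le> 1"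
    and ac: "0 \<le> a" "a \<le> c" "a \<le> p" and b: "0 \<le> b" "b \<le> N" and e: "0 \<le> e"
    and first: "c\<^sup>2 + p\<^sup>2 \<le> e\<^sup>2" and reg: "\<gamma> * e \<le> p"
    and tp: "N\<^sup>2 + a\<^sup>2 \<le> c\<^sup>2 + 2 * \<epsilon> * a * N"
    and mid: "2 * \<gamma>\<^sup>2 * (c\<^sup>2 + b\<^sup>2) \<le> (1 + \<gamma>\<^sup>2) * a\<^sup>2"
  shows "b + \<epsilon> * a \<le> e"
proof (rule ccontr)
  assume "\<not> b + \<epsilon> * a \<le> e"
  then have viol: "e < b + \<epsilon> * a" by simp
  have g0: "0 < \<gamma>\<^sup>2" using gam by simp
  have a0: "0 < a"
  proof (rule ccontr)
    assume "\<not> 0 < a"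
    then have "a = 0" using ac by simp
    with mid have "\<gamma>\<^sup>2 * (c\<^sup>2 + b\<^sup>2) \<le> 0" by simp
    then have "b = 0"
      using g0 by (simp add: mult_le_0_iff sum_power2_le_zero_iff)
    with viol e \<open>a = 0\<close> show False by simp
  qed
  \<comment> \<open>At \<open>\<gamma> = 1\<close> the premise \<open>hyp\<close> is vacuous, but
    then \<open>p \<ge> e\<close>, and \<open>first\<close> leaves \<open>c = 0\<close>, against
    \<open>0 < a \<le> c\<close>.\<close>
  have lt1: "\<gamma> < 1"
  proof (rule ccontr)
    assume "\<not> \<gamma> < 1"
    with gam have "\<gamma> = 1" by simp
    with reg have "e\<^sup>2 \<le> p\<^sup>2" using e by (intro power_mono) auto
    with first have "c\<^sup>2 \<le> 0" by linarith
    with ac a0 show False by simp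
  qed
  with hyp have hyp': "2 * \<epsilon> + 2 * \<epsilon>\<^sup>2 \<le> (2 * \<gamma> - \<gamma>\<^sup>2) / (1 - \<gamma>\<^sup>2)" by simp
  have "a\<^sup>2 \<le> c\<^sup>2" "a\<^sup>2 \<le> p\<^sup>2" using ac by (auto intro: power_mono)
  then have ca: "c\<^sup>2 + a\<^sup>2 \<le> e\<^sup>2" and aa: "2 * a\<^sup>2 \<le> e\<^sup>2" using first by auto
  show False
  proof (cases "\<epsilon> \<le> 9 / 20")
    case True
    have ae: "a \<le> e"
    proof (rule power2_le_imp_le[OF _ e])
      show "a\<^sup>2 \<le> e\<^sup>2" using aa zero_le_power2[of a] by linarith
    qed
    have e2: "\<epsilon>\<^sup>2 \<le> 81 / 400"
      using power_mono[of \<epsilon> "9/20" 2] eps True by (simp add: power2_eq_square)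
    have bea: "\<epsilon> * a \<le> b"
    proof (rule ccontr)
      assume "\<not> \<epsilon> * a \<le> b"
      moreover have "\<epsilon> * a \<le> (9/20) * a" using True ac by (intro mult_right_mono) auto
      ultimately show False using viol ae a0 by linarith
    qed
    have "(b - \<epsilon> * a)\<^sup>2 \<le> (N - \<epsilon> * a)\<^sup>2" using bea b by (intro power_mono) auto
    with tp have tpb: "b\<^sup>2 + a\<^sup>2 \<le> c\<^sup>2 + 2 * \<epsilon> * a * b"
      by (simp add: power2_diff algebra_simps)
    have "e\<^sup>2 < (b + \<epsilon> * a)\<^sup>2" using viol e by (intro power_strict_mono) auto
    with tpb ca have "a * ((2 - \<epsilon>\<^sup>2) * a) < a * (4 * \<epsilon> * b)"
      by (simp add: power2_sum algebra_simps power2_eq_square)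
    \<comment> \<open>The convex projection contributes a second \<open>a\<^sup>2\<close> through
      \<open>ca\<close>, hence \<open>q = 2\<close> below.\<close>
    then have k1: "(2 - \<epsilon>\<^sup>2) * a < 4 * \<epsilon> * b" using a0 by simp
    have k6: "\<gamma>\<^sup>2 * (4 - 8 * \<epsilon>\<^sup>2) \<le> 4 * \<epsilon>\<^sup>2"
      using median_bound[of a \<epsilon> b 2 c \<gamma>] a0 eps b e2 tpb mid k1 by simp
    define m where "m = \<epsilon> * (10 + 7 * \<epsilon>) / 10"
    have m10: "10 * m = \<epsilon> * (10 + 7 * \<epsilon>)" by (simp add: m_def)
    have m0: "0 \<le> m" using eps by (simp add: m_def)
    have m1: "m \<le> 1"
      using mult_mono[of \<epsilon> "9/20" "10 + 7 * \<epsilon>" 20] True eps m10 by simp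
    have eq: "100 * ((2 * \<epsilon> + 2 * \<epsilon>\<^sup>2) * (1 - m\<^sup>2) - (2 * m - m\<^sup>2))
        = \<epsilon>\<^sup>2 * (60 + (10 + 7 * \<epsilon>)\<^sup>2 * (1 - 2 * \<epsilon> - 2 * \<epsilon>\<^sup>2))"
      using m10 by algebra
    have "0 \<le> (2 * \<epsilon> + 2 * \<epsilon>\<^sup>2) * (1 - m\<^sup>2) - (2 * m - m\<^sup>2)"
      by (rule mult_left_le_imp_le[where c = 100], unfold eq)
        (use poly_small_margin[OF eps(1) True] in simp_all)
    from gamma_ge[OF eps(1) gam(1) lt1 m1 hyp' this] have "m \<le> \<gamma>" .
    then have "m\<^sup>2 \<le> \<gamma>\<^sup>2" using m0 by (intro power_mono)
    then have "m\<^sup>2 * (4 - 8 * \<epsilon>\<^sup>2) \<le> \<gamma>\<^sup>2 * (4 - 8 * \<epsilon>\<^sup>2)"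
      using e2 by (intro mult_right_mono) auto
    from this k6 have k7: "m\<^sup>2 * (4 - 8 * \<epsilon>\<^sup>2) \<le> 4 * \<epsilon>\<^sup>2" by (rule order_trans)
    \<comment> \<open>The terms in \<open>\<epsilon>\<^sup>2\<close> cancel and
      \<open>\<epsilon> ^ 3\<close> splits off; the cofactor is still positive at 9/20, where it is
      smallest.\<close>
    have eq: "\<epsilon> ^ 3 * (560 - 604 * \<epsilon> - 1120 * \<epsilon>\<^sup>2 - 392 * (\<epsilon> * \<epsilon>\<^sup>2))
        = 100 * (m\<^sup>2 * (4 - 8 * \<epsilon>\<^sup>2) - 4 * \<epsilon>\<^sup>2)"
      using m10 by algebra
    have "\<epsilon> ^ 3 * (560 - 604 * \<epsilon> - 1120 * \<epsilon>\<^sup>2 - 392 * (\<epsilon> * \<epsilon>\<^sup>2)) \<le> 0"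
      unfolding eq using k7 by simp
    moreover have "\<epsilon> ^ 3 > 0" using k1 e2 a0 b eps(1) by (cases "\<epsilon> = 0") auto
    ultimately have "560 - 604 * \<epsilon> - 1120 * \<epsilon>\<^sup>2 - 392 * (\<epsilon> * \<epsilon>\<^sup>2) \<le> 0"
      by (meson mult_pos_pos not_le)
    moreover have "\<epsilon> * \<epsilon>\<^sup>2 \<le> (9/20) * (81/400)"
      using True e2 eps by (intro mult_mono) auto
    ultimately show False using True e2 by linarith
  next
    case False
    then have el: "9 / 20 \<le> \<epsilon>" by simp
    define n where "n = 11 + 15 * \<epsilon>"
    define m where "m = n / 30"
    \<comment> \<open>The failed inequality and \<open>e \<ge> 707/500 * a\<close> give
      \<open>b > w * a\<close>; with \<open>c \<ge> a\<close>, \<open>mid\<close> then forces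
      \<open>\<gamma>\<^sup>2 * (1 + 2 * w\<^sup>2) < 1\<close>.\<close>
    define w where "w = (707 - 500 * \<epsilon>) / 500"
    have n30: "n = 30 * m" and w500: "707 - 500 * \<epsilon> = 500 * w" by (simp_all add: m_def w_def)
    note margin = poly_large_margin[OF el eps(2) n_def]
    have m: "0 \<le> m" "m \<le> 1" using eps by (simp_all add: m_def n_def)
    have eq: "900 * ((2 * \<epsilon> + 2 * \<epsilon>\<^sup>2) * (1 - m\<^sup>2) - (2 * m - m\<^sup>2))
        = (2 * \<epsilon> + 2 * \<epsilon>\<^sup>2) * (900 - n\<^sup>2) - (60 * n - n\<^sup>2)"
      unfolding n30 by algebra
    have "0 \<le> (2 * \<epsilon> + 2 * \<epsilon>\<^sup>2) * (1 - m\<^sup>2) - (2 * m - m\<^sup>2)"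
      by (rule mult_left_le_imp_le[where c = 900], unfold eq) (use margin(1) in simp_all)
    from gamma_ge[OF eps(1) gam(1) lt1 m(2) hyp' this] have "m \<le> \<gamma>" .
    then have "m\<^sup>2 \<le> \<gamma>\<^sup>2" using m by (intro power_mono)
    then have mono: "m\<^sup>2 * (1 + 2 * w\<^sup>2) \<le> \<gamma>\<^sup>2 * (1 + 2 * w\<^sup>2)" by (intro mult_right_mono) auto
    have "225000000 * (m\<^sup>2 * (1 + 2 * w\<^sup>2))
        = n\<^sup>2 * (250000 + 2 * (707 - 500 * \<epsilon>)\<^sup>2)"
      unfolding n30 w500 by algebra
    then have one: "1 \<le> m\<^sup>2 * (1 + 2 * w\<^sup>2)" using margin(2) by simp
    from one mono have ge: "1 \<le> \<gamma>\<^sup>2 * (1 + 2 * w\<^sup>2)" by (rule order_trans)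
    have "(707 / 500 * a)\<^sup>2 \<le> 2 * a\<^sup>2" by (simp add: power_mult_distrib power2_eq_square)
    with aa have "707 / 500 * a \<le> e" by (intro power2_le_imp_le[OF _ e]) linarith
    with viol have "w * a < b" unfolding w_def by (simp add: field_simps)
    moreover have "0 \<le> w * a" using eps a0 unfolding w_def by simp
    ultimately have wb: "w\<^sup>2 * a\<^sup>2 < b\<^sup>2"
      using power_strict_mono[of "w * a" b 2] by (simp add: power_mult_distrib)
    have "2 * \<gamma>\<^sup>2 * (a\<^sup>2 + w\<^sup>2 * a\<^sup>2) < 2 * \<gamma>\<^sup>2 * (c\<^sup>2 + b\<^sup>2)"
      using wb \<open>a\<^sup>2 \<le> c\<^sup>2\<close> g0 by (intro mult_strict_left_mono) auto
    with mid have "(\<gamma>\<^sup>2 * (1 + 2 * w\<^sup>2)) * a\<^sup>2 < 1 * a\<^sup>2"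
      by (simp add: algebra_simps)
    then have "\<gamma>\<^sup>2 * (1 + 2 * w\<^sup>2) < 1" using a0 by (simp only: mult_less_cancel_right) simp
    with ge show False by simp
  qed
qed

section \<open>Three-point inequalities for projections\<close>

lemma projector_dist_le:
  assumes "y \<in> projector \<Omega> x" "s \<in> \<Omega>"
  shows "dist x y \<le> dist x s"
  using assms infdist_le[of s \<Omega> x] by (simp add: projector_def dist_norm)

text \<open>Law of cosines at \<open>y\<close>; \<open>\<epsilon> = 0\<close> is the obtuse angle of
  the convex case.\<close>

lemma three_point_of_inner:
  fixes x y s :: "'a::real_inner"
  assumes "inner (x - y) (s - y) \<le> \<epsilon> * norm (x - y) * norm (s - y)"
  shows "(dist y s)\<^sup>2 + (dist x y)\<^sup>2 \<le> (dist x s)\<^sup>2 + 2 * \<epsilon> * dist x y * dist y s"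
proof -
  have "(dist x s)\<^sup>2 = (dist x y)\<^sup>2 + (dist y s)\<^sup>2 - 2 * inner (x - y) (s - y)"
    unfolding dist_norm power2_norm_eq_inner by (simp add: inner_diff inner_commute algebra_simps)
  with assms show ?thesis by (simp add: dist_norm norm_minus_commute mult_ac)
qed

lemma subregular_three_point:
  assumes "subregular \<epsilon> \<delta> \<Omega> xh S" "y \<in> projector \<Omega> x" "y \<in> cball xh \<delta>" "s \<in> S \<inter> cball xh \<delta>"
  shows "(dist y s)\<^sup>2 + (dist x y)\<^sup>2 \<le> (dist x s)\<^sup>2 + 2 * \<epsilon> * dist x y * dist y s"
proof -
  have "x - y \<in> proximal_normal_cone \<Omega> y"
    unfolding proximal_normal_cone_def pos_cone_def using assms(2) by (auto intro: hull_inc)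
  moreover have "y \<in> cball xh \<delta> \<inter> \<Omega>" using assms by (simp add: projector_def)
  ultimately show ?thesis
    using assms(1,4) unfolding subregular_def by (intro three_point_of_inner) blast
qed

lemma subregular_min_one:
  assumes "subregular \<epsilon> \<delta> \<Omega> xh S"
  shows "subregular (min \<epsilon> 1) \<delta> \<Omega> xh S"
proof (cases "\<epsilon> \<le> 1")
  case False
  then show ?thesis unfolding subregular_def by (auto simp: norm_cauchy_schwarz)
qed (use assms in simp)

lemma convex_three_point:
  fixes \<Omega> :: "'a::euclidean_space set"
  assumes "convex \<Omega>" "closed \<Omega>" "y \<in> projector \<Omega> x" "s \<in> \<Omega>"
  shows "(dist y s)\<^sup>2 + (dist x y)\<^sup>2 \<le> (dist x s)\<^sup>2"
proof -
  have "inner (x - y) (s - y) \<le> 0"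
    using assms projector_dist_le[OF assms(3)]
    by (intro any_closest_point_dot) (auto simp: projector_def)
  then show ?thesis using three_point_of_inner[of x y s 0] by simp
qed

lemma infdist_nearest:
  fixes S :: "'a::heine_borel set"
  assumes "closed S" "S \<noteq> {}"
  obtains s where "s \<in> S" "dist x s = infdist x S"
  using infdist_attains_inf[OF assms] by metis

text \<open>A single projection controls only squared distances. Composing two gives a product of
  roots, which for equal factors is the factor itself, as in (a) and (c).\<close>

lemma le_mult_of_power2_le:
  fixes a c p q :: real
  assumes "a\<^sup>2 \<le> q * b\<^sup>2" "b\<^sup>2 \<le> p * c\<^sup>2" "0 \<le> q" "0 \<le> p" "0 \<le> c"
  shows "a \<le> sqrt q * sqrt p * c"
proof (rule power2_le_imp_le)
  have "a\<^sup>2 \<le> q * (p * c\<^sup>2)" using assms by (meson mult_left_mono order_trans)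
  then show "a\<^sup>2 \<le> (sqrt q * sqrt p * c)\<^sup>2" using assms by (simp add: power_mult_distrib)
qed (use assms in simp)

section \<open>Consequences of linear regularity for a pair of points\<close>

text \<open>Symmetric in \<open>A\<close> and \<open>B\<close>, so that each lemma on a projection
  onto \<open>B\<close> also serves for one onto \<open>A\<close>.\<close>

definition regular_pair ::
    "'a::euclidean_space set \<Rightarrow> 'a set \<Rightarrow> 'a set \<Rightarrow> 'a \<Rightarrow> real \<Rightarrow> real \<Rightarrow> bool" where
  "regular_pair A B S xh \<delta> \<gamma> \<longleftrightarrow>
     closed A \<and> closed B \<and> S = A \<inter> B \<and> xh \<in> S \<and> 0 < \<gamma> \<and> \<gamma> \<le> 1 \<and>
     (\<forall>x \<in> cball xh \<delta>. \<gamma> * infdist x S \<le> max (infdist x A) (infdist x B))"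

lemma regular_pairD:
  assumes "regular_pair A B S xh \<delta> \<gamma>"
  shows "closed A" "closed B" "S = A \<inter> B" "xh \<in> S" "0 < \<gamma>" "\<gamma> \<le> 1"
    and "x \<in> cball xh \<delta> \<Longrightarrow> \<gamma> * infdist x S \<le> max (infdist x A) (infdist x B)"
  using assms unfolding regular_pair_def by blast+

lemma regular_pair_swap: "regular_pair A B S xh \<delta> \<gamma> \<Longrightarrow> regular_pair B A S xh \<delta> \<gamma>"
  by (auto simp: regular_pair_def max.commute)

lemma regular_pair_nearest:
  assumes rp: "regular_pair A B S xh \<delta> \<gamma>"
  obtains s where "s \<in> S" "dist x s = infdist x S"
  using infdist_nearest[of S x] regular_pairD(1-4)[OF rp] that by blast

lemma projection_gap_le:
  assumes rp: "regular_pair A B S xh \<delta> \<gamma>"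
    and "y \<in> projector B x"
  shows "dist x y \<le> infdist x S"
proof -
  obtain s where "s \<in> S" "dist x s = infdist x S" by (rule regular_pair_nearest[OF rp])
  then show ?thesis using projector_dist_le[OF assms(2), of s] regular_pairD(3)[OF rp] by simp
qed

lemma regular_gap_ge:
  assumes rp: "regular_pair A B S xh \<delta> \<gamma>"
    and "x \<in> A" "x \<in> cball xh \<delta>" "y \<in> projector B x"
  shows "\<gamma> * infdist x S \<le> dist x y"
  using regular_pairD(7)[OF rp assms(3)] assms(2,4) by (simp add: projector_def dist_norm infdist_nonneg)

text \<open>Take \<open>s\<close> in \<open>S\<close> nearest to the midpoint \<open>w\<close>.
  Regularity bounds the median from \<open>s\<close> to \<open>w\<close> by
  \<open>dist x y / (2 * \<gamma>)\<close>, and the median formula turns this into a bound on the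
  two sides at \<open>s\<close>, which dominate the distances to \<open>S\<close>.\<close>

lemma midpoint_regularity:
  assumes rp: "regular_pair A B S xh \<delta> \<gamma>"
    and "x \<in> A" "y \<in> B" "x \<in> cball xh \<delta>" "y \<in> cball xh \<delta>"
  shows "2 * \<gamma>\<^sup>2 * ((infdist x S)\<^sup>2 + (infdist y S)\<^sup>2) \<le> (1 + \<gamma>\<^sup>2) * (dist x y)\<^sup>2"
proof -
  note gam = regular_pairD(5,6)[OF rp]
  define w where "w = midpoint x y"
  have w: "w \<in> cball xh \<delta>"
    unfolding w_def using assms
    by (meson closed_segment_subset convex_cball midpoint_in_closed_segment subsetD)
  obtain s where s: "s \<in> S" "dist w s = infdist w S" by (rule regular_pair_nearest[OF rp])
  have "infdist w A \<le> dist x y / 2" "infdist w B \<le> dist x y / 2"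
    using infdist_le[OF assms(2), of w] infdist_le[OF assms(3), of w]
    by (simp_all add: w_def dist_midpoint)
  with regular_pairD(7)[OF rp w] s have "\<gamma> * dist w s \<le> dist x y / 2" by simp
  then have "(\<gamma> * dist w s)\<^sup>2 \<le> (dist x y / 2)\<^sup>2" using gam by (intro power_mono) auto
  moreover have "4 * (dist w s)\<^sup>2 = 2 * (dist x s)\<^sup>2 + 2 * (dist y s)\<^sup>2 - (dist x y)\<^sup>2"
    unfolding w_def midpoint_def dist_norm power2_norm_eq_inner
    by (simp add: inner_diff inner_add inner_commute field_simps)
  moreover have "4 * (\<gamma> * dist w s)\<^sup>2 = \<gamma>\<^sup>2 * (4 * (dist w s)\<^sup>2)"
    by (simp add: power_mult_distrib)
  ultimately have "\<gamma>\<^sup>2 * (2 * (dist x s)\<^sup>2 + 2 * (dist y s)\<^sup>2 - (dist x y)\<^sup>2) \<le> (dist x y)\<^sup>2"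
    by (simp add: power_divide)
  moreover have "\<gamma>\<^sup>2 * (2 * (infdist x S)\<^sup>2 + 2 * (infdist y S)\<^sup>2 - (dist x y)\<^sup>2)
      \<le> \<gamma>\<^sup>2 * (2 * (dist x s)\<^sup>2 + 2 * (dist y s)\<^sup>2 - (dist x y)\<^sup>2)"
    using infdist_le[OF s(1)]
    by (intro mult_left_mono diff_mono add_mono power_mono) (auto simp: infdist_nonneg)
  ultimately show ?thesis by (simp add: algebra_simps)
qed

section \<open>Single projections and the invariant\<close>

lemma subregular_projection_step:
  assumes rp: "regular_pair A B S xh \<delta> \<gamma>"
    and x: "x \<in> A" "dist x xh + infdist x S \<le> \<delta>"
    and sub: "subregular \<epsilon> \<delta> B xh S" "0 \<le> \<epsilon>" "\<epsilon> \<le> 1"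
    and y: "y \<in> projector B x"
  shows "y \<in> cball xh \<delta>"
    and "dist y xh \<le> dist x xh + \<epsilon> * dist x y"
    and "\<exists>N. infdist y S \<le> N \<and> N\<^sup>2 + (dist x y)\<^sup>2 \<le> (infdist x S)\<^sup>2 + 2 * \<epsilon> * dist x y * N"
    and "(infdist y S)\<^sup>2 \<le> (1 - \<gamma>\<^sup>2 + (2 * \<epsilon> + 2 * \<epsilon>\<^sup>2)) * (infdist x S)\<^sup>2"
proof -
  note xh = regular_pairD(4)[OF rp] and gam = regular_pairD(5,6)[OF rp]
  have xb: "x \<in> cball xh \<delta>" using x(2) infdist_nonneg[of x S] by (simp add: dist_commute)
  have d: "0 \<le> \<delta>" using x(2) infdist_nonneg[of x S] zero_le_dist[of x xh] by linarith
  \<comment> \<open>Neither \<open>y\<close> nor the nearest point \<open>s\<close> is farther from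
    \<open>x\<close> than \<open>infdist x S\<close>, so the hypothesis on \<open>x\<close> keeps
    both in the ball.\<close>
  show yb: "y \<in> cball xh \<delta>"
    using projection_gap_le[OF rp y] x(2) dist_triangle[of y xh x] by (simp add: dist_commute)
  \<comment> \<open>Completing the square leaves
    \<open>(1 - \<epsilon>\<^sup>2) * a\<^sup>2\<close>, dropped as
    \<open>\<epsilon> \<le> 1\<close>. With \<open>xh\<close> as reference point this bounds the
    drift from the centre, with \<open>s\<close> the distance \<open>dist y s\<close>.\<close>
  have grow: "N \<le> c + \<epsilon> * a" if "N\<^sup>2 + a\<^sup>2 \<le> c\<^sup>2 + 2 * \<epsilon> * a * N" "0 \<le> c" for N a c :: real
  proof -
    have "\<epsilon>\<^sup>2 * a\<^sup>2 \<le> 1 * a\<^sup>2" using sub by (intro mult_right_mono) (auto simp: power_le_one)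
    with that have "(N - \<epsilon> * a)\<^sup>2 \<le> c\<^sup>2" by (simp add: power2_diff power_mult_distrib algebra_simps)
    then have "N - \<epsilon> * a \<le> c" using that(2) by (rule power2_le_imp_le)
    then show ?thesis by simp
  qed
  show "dist y xh \<le> dist x xh + \<epsilon> * dist x y"
    using subregular_three_point[OF sub(1) y yb, of xh] xh d by (intro grow) auto
  obtain s where s: "s \<in> S" "dist x s = infdist x S" by (rule regular_pair_nearest[OF rp])
  have sb: "s \<in> cball xh \<delta>"
    using s x(2) dist_triangle[of s xh x] by (simp add: dist_commute)
  have tp: "(dist y s)\<^sup>2 + (dist x y)\<^sup>2 \<le> (infdist x S)\<^sup>2 + 2 * \<epsilon> * dist x y * dist y s"
    using subregular_three_point[OF sub(1) y yb, of s] s sb by simp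
  then show "\<exists>N. infdist y S \<le> N \<and> N\<^sup>2 + (dist x y)\<^sup>2 \<le> (infdist x S)\<^sup>2 + 2 * \<epsilon> * dist x y * N"
    using infdist_le[OF s(1)] by blast
  have ea: "\<epsilon> * dist x y \<le> \<epsilon> * infdist x S" using projection_gap_le[OF rp y] sub by (intro mult_left_mono)
  have "dist y s \<le> (1 + \<epsilon>) * infdist x S"
    using grow[OF tp infdist_nonneg] ea by (simp add: algebra_simps)
  \<comment> \<open>Twice this product is the error term of \<open>tp\<close>; it is the source of
    \<open>2 * \<epsilon> + 2 * \<epsilon>\<^sup>2\<close> in the rate.\<close>
  then have "(\<epsilon> * dist x y) * dist y s \<le> (\<epsilon> * infdist x S) * ((1 + \<epsilon>) * infdist x S)"
    using sub infdist_nonneg[of x S] by (intro mult_mono[OF ea]) simp_all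
  moreover have "(\<gamma> * infdist x S)\<^sup>2 \<le> (dist x y)\<^sup>2"
    using regular_gap_ge[OF rp x(1) xb y] gam by (intro power_mono) (auto simp: infdist_nonneg)
  moreover have "(infdist y S)\<^sup>2 \<le> (dist y s)\<^sup>2"
    using infdist_le[OF s(1)] by (intro power_mono) (auto simp: infdist_nonneg)
  ultimately show "(infdist y S)\<^sup>2 \<le> (1 - \<gamma>\<^sup>2 + (2 * \<epsilon> + 2 * \<epsilon>\<^sup>2)) * (infdist x S)\<^sup>2"
    using tp by (simp add: algebra_simps power2_eq_square)
qed

text \<open>The obtuse-angle inequality holds for all points of \<open>B\<close>, near or far, and
  projecting never moves away from \<open>xh\<close>. Hence (c) can start anywhere in the full
  ball.\<close>

lemma convex_projection_step:
  assumes rp: "regular_pair A B S xh \<delta> \<gamma>"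
    and x: "x \<in> A" "x \<in> cball xh \<delta>" and "convex B" and y: "y \<in> projector B x"
  shows "dist y xh \<le> dist x xh"
    and "(infdist y S)\<^sup>2 + (dist x y)\<^sup>2 \<le> (infdist x S)\<^sup>2"
    and "(infdist y S)\<^sup>2 \<le> (1 - \<gamma>\<^sup>2) * (infdist x S)\<^sup>2"
proof -
  note S = regular_pairD(3)[OF rp] and xh = regular_pairD(4)[OF rp] and gam = regular_pairD(5,6)[OF rp]
  note tp = convex_three_point[OF \<open>convex B\<close> regular_pairD(2)[OF rp] y]
  have "xh \<in> B" using xh S by simp
  then have "(dist y xh)\<^sup>2 \<le> (dist x xh)\<^sup>2"
    using tp[of xh] zero_le_power2[of "dist x y"] by linarith
  then show "dist y xh \<le> dist x xh" by (rule power2_le_imp_le) simp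
  obtain s where s: "s \<in> S" "dist x s = infdist x S" by (rule regular_pair_nearest[OF rp])
  have "(infdist y S)\<^sup>2 \<le> (dist y s)\<^sup>2"
    using infdist_le[OF s(1)] by (intro power_mono) (auto simp: infdist_nonneg)
  with tp[of s] s S show *: "(infdist y S)\<^sup>2 + (dist x y)\<^sup>2 \<le> (infdist x S)\<^sup>2" by simp
  have "(\<gamma> * infdist x S)\<^sup>2 \<le> (dist x y)\<^sup>2"
    using regular_gap_ge[OF rp x y] gam by (intro power_mono) (auto simp: infdist_nonneg)
  with * show "(infdist y S)\<^sup>2 \<le> (1 - \<gamma>\<^sup>2) * (infdist x S)\<^sup>2"
    by (simp add: algebra_simps power_mult_distrib)
qed

lemma subregular_step_invariant:
  assumes rp: "regular_pair A B S xh \<delta> \<gamma>"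
    and x: "x \<in> A" "dist x xh + infdist x S \<le> \<delta>"
    and sub: "subregular \<epsilon> \<delta> B xh S" "0 \<le> \<epsilon>" "2 * \<epsilon> + 2 * \<epsilon>\<^sup>2 \<le> \<gamma>\<^sup>2"
    and y: "y \<in> projector B x"
  shows "y \<in> B" "dist y xh + infdist y S \<le> \<delta>"
    and "(infdist y S)\<^sup>2 \<le> (1 - \<gamma>\<^sup>2 + (2 * \<epsilon> + 2 * \<epsilon>\<^sup>2)) * (infdist x S)\<^sup>2"
proof -
  note gam = regular_pairD(5,6)[OF rp]
  show yB: "y \<in> B" using y by (simp add: projector_def)
  have "\<gamma>\<^sup>2 \<le> 1" using gam by (simp add: power_le_one)
  with sub(3) zero_le_power2[of \<epsilon>] have e1: "\<epsilon> \<le> 1" by linarith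
  note st = subregular_projection_step[OF rp x sub(1,2) e1 y]
  obtain N where N: "infdist y S \<le> N"
      "N\<^sup>2 + (dist x y)\<^sup>2 \<le> (infdist x S)\<^sup>2 + 2 * \<epsilon> * dist x y * N"
    using st(3) by blast
  have xb: "x \<in> cball xh \<delta>" using x(2) infdist_nonneg[of x S] by (simp add: dist_commute)
  have "infdist y S + \<epsilon> * dist x y \<le> infdist x S"
    using step_decrease[OF sub(2,3) gam zero_le_dist projection_gap_le[OF rp y] infdist_nonneg N
      midpoint_regularity[OF rp x(1) yB xb st(1)]] .
  with st(2) x(2) show "dist y xh + infdist y S \<le> \<delta>" by simp
  show "(infdist y S)\<^sup>2 \<le> (1 - \<gamma>\<^sup>2 + (2 * \<epsilon> + 2 * \<epsilon>\<^sup>2)) * (infdist x S)\<^sup>2" by (rule st(4))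
qed

text \<open>
  The assumption \<open>\<epsilon> \<le> 1\<close> loses nothing: for \<open>\<epsilon> \<ge> 1\<close> subregularity is just Cauchy-Schwarz, so
  \<open>\<epsilon>\<close> can be lowered to 1.
\<close>

lemma mixed_cycle_invariant:
  assumes rp: "regular_pair A B S xh \<delta> \<gamma>"
    and x: "x \<in> A" "dist x xh + infdist x S \<le> \<delta>"
    and sub: "subregular \<epsilon> \<delta> A xh S" "0 \<le> \<epsilon>" "\<epsilon> \<le> 1" and "convex B"
    and hyp: "\<gamma> \<noteq> 1 \<longrightarrow> 2 * \<epsilon> + 2 * \<epsilon>\<^sup>2 \<le> (2 * \<gamma> - \<gamma>\<^sup>2) / (1 - \<gamma>\<^sup>2)"
    and y: "y \<in> projector B x" and z: "z \<in> projector A y"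
  shows "z \<in> A" "dist z xh + infdist z S \<le> \<delta>"
    and "infdist z S
      \<le> sqrt (1 - \<gamma>\<^sup>2 + (2 * \<epsilon> + 2 * \<epsilon>\<^sup>2)) * sqrt (1 - \<gamma>\<^sup>2) * infdist x S"
proof -
  note pr = regular_pair_swap[OF rp] and gam = regular_pairD(5,6)[OF rp]
  have yB: "y \<in> B" using y by (simp add: projector_def)
  show zA: "z \<in> A" using z by (simp add: projector_def)
  have xb: "x \<in> cball xh \<delta>" using x(2) infdist_nonneg[of x S] by (simp add: dist_commute)
  note cs = convex_projection_step[OF rp x(1) xb \<open>convex B\<close> y]
  have "(infdist y S)\<^sup>2 \<le> (infdist x S)\<^sup>2" using cs(2) zero_le_power2[of "dist x y"] by linarith
  then have "infdist y S \<le> infdist x S" by (rule power2_le_imp_le) (rule infdist_nonneg)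
  with cs(1) x(2) have y2: "dist y xh + infdist y S \<le> \<delta>" by linarith
  then have yb: "y \<in> cball xh \<delta>" using infdist_nonneg[of y S] by (simp add: dist_commute)
  note st = subregular_projection_step[OF pr yB y2 sub z]
  obtain N where N: "infdist z S \<le> N"
      "N\<^sup>2 + (dist y z)\<^sup>2 \<le> (infdist y S)\<^sup>2 + 2 * \<epsilon> * dist y z * N"
    using st(3) by blast
  \<comment> \<open>\<open>x\<close> competes with \<open>z\<close> in the projection of
    \<open>y\<close> onto \<open>A\<close>; this is the premise \<open>a \<le> p\<close> of
    \<open>cycle_decrease\<close>.\<close>
  have "dist y z \<le> dist x y" using projector_dist_le[OF z x(1)] by (simp add: dist_commute)
  then have "infdist z S + \<epsilon> * dist y z \<le> infdist x S"
    using cycle_decrease[OF sub(2,3) hyp gam zero_le_dist projection_gap_le[OF pr z] _ infdist_nonneg N(1)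
      infdist_nonneg cs(2) regular_gap_ge[OF rp x(1) xb y] N(2) midpoint_regularity[OF pr yB zA yb st(1)]] by simp
  with st(2) cs(1) x(2) show "dist z xh + infdist z S \<le> \<delta>" by simp
  have g: "0 \<le> 1 - \<gamma>\<^sup>2" using gam by (simp add: power_le_one)
  then have "0 \<le> 1 - \<gamma>\<^sup>2 + (2 * \<epsilon> + 2 * \<epsilon>\<^sup>2)" using sub(2) by simp
  then show "infdist z S
      \<le> sqrt (1 - \<gamma>\<^sup>2 + (2 * \<epsilon> + 2 * \<epsilon>\<^sup>2)) * sqrt (1 - \<gamma>\<^sup>2) * infdist x S"
    by (rule le_mult_of_power2_le[OF st(4) cs(3) _ g infdist_nonneg])
qed

section \<open>The regularity modulus and the final assembly\<close>

text \<open>The infimum is itself a valid factor: for a positive maximum divide by it and pass to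
  the infimum, for a zero maximum any admissible constant already gives distance 0.\<close>

lemma regularity_modulus_bound:
  assumes "locally_linearly_regular A B xh \<delta>" "x \<in> cball xh \<delta>"
  shows "infdist x (A \<inter> B) \<le> regularity_modulus A B xh \<delta> * max (infdist x A) (infdist x B)"
proof -
  let ?K = "regularity_constants A B xh \<delta>" and ?m = "max (infdist x A) (infdist x B)"
  have ne: "?K \<noteq> {}" using assms by (simp add: locally_linearly_regular_def)
  have le: "infdist x (A \<inter> B) \<le> k * ?m" if "k \<in> ?K" for k
    using that assms(2) unfolding regularity_constants_def by blast
  have m0: "0 \<le> ?m" by (simp add: infdist_nonneg le_max_iff_disj)
  show ?thesis
  proof (cases "?m = 0")
    case True
    with le ne show ?thesis by fastforce
  next
    case False
    with m0 have mp: "0 < ?m" by simp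
    have "infdist x (A \<inter> B) / ?m \<le> Inf ?K"
      using ne le mp by (intro cInf_greatest) (auto simp only: pos_divide_le_eq)
    with mp show ?thesis unfolding regularity_modulus_def by (simp only: pos_divide_le_eq)
  qed
qed

text \<open>This yields \<open>\<gamma> \<le> 1\<close>. If the ball lay inside the intersection,
  every positive constant would be admissible, also half the modulus. So some point has positive
  distance to the intersection, and there both distances in the maximum are no larger.\<close>

lemma regularity_modulus_ge_1:
  assumes "locally_linearly_regular A B xh \<delta>" "A \<inter> B \<noteq> {}"
    and pos: "0 < regularity_modulus A B xh \<delta>"
  shows "1 \<le> regularity_modulus A B xh \<delta>"
proof -
  let ?\<kappa> = "regularity_modulus A B xh \<delta>" and ?K = "regularity_constants A B xh \<delta>"
  have "\<exists>x\<in>cball xh \<delta>. infdist x (A \<inter> B) \<noteq> 0"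
  proof (rule ccontr)
    assume "\<not> ?thesis"
    then have "?\<kappa> / 2 \<in> ?K"
      using pos unfolding regularity_constants_def by (simp add: infdist_nonneg le_max_iff_disj)
    moreover have "bdd_below ?K"
      by (rule bdd_belowI[of _ 0]) (simp add: regularity_constants_def)
    ultimately have "?\<kappa> \<le> ?\<kappa> / 2"
      unfolding regularity_modulus_def by (rule cInf_lower)
    with pos show False by simp
  qed
  then obtain x where x: "x \<in> cball xh \<delta>" "0 < infdist x (A \<inter> B)"
    using infdist_nonneg less_le by metis
  have "max (infdist x A) (infdist x B) \<le> infdist x (A \<inter> B)"
    using assms(2) by (auto intro: infdist_mono)
  then have "?\<kappa> * max (infdist x A) (infdist x B) \<le> ?\<kappa> * infdist x (A \<inter> B)"
    using pos by (intro mult_left_mono) auto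
  with regularity_modulus_bound[OF assms(1) x(1)]
  have "1 * infdist x (A \<inter> B) \<le> ?\<kappa> * infdist x (A \<inter> B)" by simp
  with x(2) show ?thesis by simp
qed

text \<open>In (b) the bound on \<epsilon> is guarded by \<open>\<gamma> \<noteq> 1\<close>: at
  \<open>\<gamma> = 1\<close> the quotient is 1/0, which HOL evaluates to 0, whereas the intended
  value is infinite.\<close>

theorem corollary37:
  fixes A B S :: "'a::euclidean_space set" and xh :: 'a and \<delta> \<kappa> \<gamma> :: real
    and x :: "nat \<Rightarrow> 'a"
  assumes "closed A" and "A \<noteq> {}" and "closed B" and "B \<noteq> {}"
    and "S = A \<inter> B" and "xh \<in> S" and "\<delta> > 0"
    and "locally_linearly_regular A B xh \<delta>"
    and "\<kappa> = regularity_modulus A B xh \<delta>" and "\<kappa> > 0"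
    and "\<gamma> = 1 / \<kappa>"
    and "x 0 \<in> A"
    and "\<And>n. x (2 * n + 1) \<in> projector B (x (2 * n))"
    and "\<And>n. x (2 * n + 2) \<in> projector A (x (2 * n + 1))"
  shows
    "(\<forall>\<epsilon> \<epsilon>t. \<epsilon> \<ge> 0 \<and> subregular \<epsilon> \<delta> A xh S \<and> subregular \<epsilon> \<delta> B xh S
        \<and> \<epsilon>t = 2 * \<epsilon> + 2 * \<epsilon>\<^sup>2 \<and> \<epsilon>t \<le> \<gamma>\<^sup>2
        \<and> x 0 \<in> cball xh (\<delta> / 2) \<inter> A \<longrightarrow>
        (\<forall>n. infdist (x (2 * n + 2)) S \<le> (1 - \<gamma>\<^sup>2 + \<epsilon>t) * infdist (x (2 * n)) S))
   \<and> (\<forall>\<epsilon> \<epsilon>t. \<epsilon> \<ge> 0 \<and> subregular \<epsilon> \<delta> A xh S \<and> convex B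
        \<and> \<epsilon>t = 2 * \<epsilon> + 2 * \<epsilon>\<^sup>2 \<and> (\<gamma> \<noteq> 1 \<longrightarrow> \<epsilon>t \<le> (2 * \<gamma> - \<gamma>\<^sup>2) / (1 - \<gamma>\<^sup>2))
        \<and> x 0 \<in> cball xh (\<delta> / 2) \<inter> A \<longrightarrow>
        (\<forall>n. infdist (x (2 * n + 2)) S
               \<le> sqrt (1 - \<gamma>\<^sup>2 + \<epsilon>t) * sqrt (1 - \<gamma>\<^sup>2) * infdist (x (2 * n)) S))
   \<and> (convex A \<and> convex B \<and> x 0 \<in> cball xh \<delta> \<inter> A \<longrightarrow>
        (\<forall>n. infdist (x (2 * n + 2)) S \<le> (1 - \<gamma>\<^sup>2) * infdist (x (2 * n)) S))"
proof -
  note y = assms(13) and z = assms(14)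
  have k1: "1 \<le> \<kappa>" using regularity_modulus_ge_1[of A B xh \<delta>] assms by blast
  have "\<gamma> * infdist u S \<le> max (infdist u A) (infdist u B)" if "u \<in> cball xh \<delta>" for u
    using regularity_modulus_bound[OF assms(8) that] assms(5,9-11)
    by (simp add: pos_divide_le_eq mult.commute)
  then have rp: "regular_pair A B S xh \<delta> \<gamma>"
    using assms(1,3,5,6,10,11) k1 by (simp add: regular_pair_def)
  note pr = regular_pair_swap[OF rp] and gam = regular_pairD(5,6)[OF rp]
  have g: "0 \<le> 1 - \<gamma>\<^sup>2" using gam by (simp add: power_le_one)
  \<comment> \<open>As \<open>xh\<close> lies in \<open>S\<close>, both summands are at most
    \<open>\<delta> / 2\<close>: this is where the half radius enters.\<close>
  have start: "dist (x 0) xh + infdist (x 0) S \<le> \<delta>" if "x 0 \<in> cball xh (\<delta> / 2)"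
    using that infdist_le[OF assms(6), of "x 0"] by (simp add: dist_commute)
  have "infdist (x (2 * n + 2)) S \<le> (1 - \<gamma>\<^sup>2 + (2 * \<epsilon> + 2 * \<epsilon>\<^sup>2)) * infdist (x (2 * n)) S"
    if sub: "subregular \<epsilon> \<delta> A xh S" "subregular \<epsilon> \<delta> B xh S" "0 \<le> \<epsilon>"
      and eps: "2 * \<epsilon> + 2 * \<epsilon>\<^sup>2 \<le> \<gamma>\<^sup>2" and x0: "x 0 \<in> cball xh (\<delta> / 2)" for \<epsilon> n
  proof -
    have I: "x (2 * n) \<in> A \<and> dist (x (2 * n)) xh + infdist (x (2 * n)) S \<le> \<delta>" for n
    proof (induction n)
      case 0
      then show ?case using start[OF x0] assms(12) by simp
    next
      case (Suc n)
      then have "x (2 * n) \<in> A" "dist (x (2 * n)) xh + infdist (x (2 * n)) S \<le> \<delta>" by auto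
      from subregular_step_invariant(1,2)[OF rp this sub(2,3) eps y]
      show ?case using subregular_step_invariant(1,2)[OF pr _ _ sub(1,3) eps z] by simp
    qed
    let ?q = "1 - \<gamma>\<^sup>2 + (2 * \<epsilon> + 2 * \<epsilon>\<^sup>2)"
    have q: "0 \<le> ?q" using g sub(3) by simp
    note st = subregular_step_invariant[OF rp conjunct1[OF I] conjunct2[OF I] sub(2,3) eps y[of n]]
    show ?thesis
      using le_mult_of_power2_le[OF
          subregular_step_invariant(3)[OF pr st(1,2) sub(1,3) eps z] st(3) q q infdist_nonneg] q
      by simp
  qed
  moreover have "infdist (x (2 * n + 2)) S
      \<le> sqrt (1 - \<gamma>\<^sup>2 + (2 * \<epsilon> + 2 * \<epsilon>\<^sup>2)) * sqrt (1 - \<gamma>\<^sup>2) * infdist (x (2 * n)) S"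
    if sub0: "subregular \<epsilon> \<delta> A xh S" "0 \<le> \<epsilon>" and "convex B"
      and hyp0: "\<gamma> \<noteq> 1 \<longrightarrow> 2 * \<epsilon> + 2 * \<epsilon>\<^sup>2 \<le> (2 * \<gamma> - \<gamma>\<^sup>2) / (1 - \<gamma>\<^sup>2)"
      and x0: "x 0 \<in> cball xh (\<delta> / 2)" for \<epsilon> n
  proof -
    define e where "e = min \<epsilon> 1"
    have sub: "subregular e \<delta> A xh S" "0 \<le> e" "e \<le> 1"
      using subregular_min_one[OF sub0(1)] sub0(2) by (auto simp: e_def)
    have "e \<le> \<epsilon>" by (simp add: e_def)
    then have le: "2 * e + 2 * e\<^sup>2 \<le> 2 * \<epsilon> + 2 * \<epsilon>\<^sup>2"
      using sub(2) by (intro add_mono mult_left_mono power_mono) auto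
    have hyp: "\<gamma> \<noteq> 1 \<longrightarrow> 2 * e + 2 * e\<^sup>2 \<le> (2 * \<gamma> - \<gamma>\<^sup>2) / (1 - \<gamma>\<^sup>2)"
      using hyp0 le by linarith
    note cyc = mixed_cycle_invariant[OF rp _ _ sub \<open>convex B\<close> hyp y z]
    have I: "x (2 * n) \<in> A \<and> dist (x (2 * n)) xh + infdist (x (2 * n)) S \<le> \<delta>" for n
    proof (induction n)
      case 0
      then show ?case using start[OF x0] assms(12) by simp
    next
      case (Suc n)
      then show ?case using cyc(1,2)[of n] by simp
    qed
    have "infdist (x (2 * n + 2)) S
        \<le> sqrt (1 - \<gamma>\<^sup>2 + (2 * e + 2 * e\<^sup>2)) * sqrt (1 - \<gamma>\<^sup>2) * infdist (x (2 * n)) S"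
      using cyc(3)[OF conjunct1[OF I] conjunct2[OF I]] .
    also have "\<dots> \<le> sqrt (1 - \<gamma>\<^sup>2 + (2 * \<epsilon> + 2 * \<epsilon>\<^sup>2)) * sqrt (1 - \<gamma>\<^sup>2) * infdist (x (2 * n)) S"
      using le g by (intro mult_right_mono) (auto simp: infdist_nonneg)
    finally show ?thesis .
  qed
  moreover have "infdist (x (2 * n + 2)) S \<le> (1 - \<gamma>\<^sup>2) * infdist (x (2 * n)) S"
    if conv: "convex A" "convex B" and x0: "x 0 \<in> cball xh \<delta>" for n
  proof -
    have step: "x (2 * n + 1) \<in> B \<and> x (2 * n + 1) \<in> cball xh \<delta>"
      if "x (2 * n) \<in> A \<and> x (2 * n) \<in> cball xh \<delta>" for n
      using that convex_projection_step(1)[OF rp _ _ conv(2) y[of n]] y[of n]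
      by (auto simp: projector_def dist_commute)
    have I: "x (2 * n) \<in> A \<and> x (2 * n) \<in> cball xh \<delta>" for n
    proof (induction n)
      case 0
      then show ?case using x0 assms(12) by simp
    next
      case (Suc n)
      from step[OF this] show ?case
        using convex_projection_step(1)[OF pr _ _ conv(1) z[of n]] z[of n]
        by (auto simp: projector_def dist_commute)
    qed
    show ?thesis
      using le_mult_of_power2_le[OF convex_projection_step(3)[OF pr _ _ conv(1) z[of n]]
          convex_projection_step(3)[OF rp _ _ conv(2) y[of n]] g g infdist_nonneg] step[OF I[of n]] I[of n] g
      by simp
  qed
  ultimately show ?thesis by blast
qed

end
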